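(* For each cardinal $\kappa$, the following are equivalent: (1) $\kappa<\operatorname{add}(\mathfrak{D}_{\mathrm{fin}},\mathfrak{D})$; (2) for each sequence $\langle (g_\alpha,\mathcal{U}_\alpha):\alpha<\kappa\rangle$ with each $\mathcal{U}_\alpha$ a nonprincipal ultrafilter on $\mathbb{N}$ and each $g_\alpha\in\mathbb{N}^{\mathbb{N}}$, there exists $g\in\mathbb{N}^{\mathbb{N}}$ such that for each $\alpha<\kappa$, $\{n: g_\alpha(n)\le g(n)\}\in\mathcal{U}_\alpha$.
   Context: $\mathbb{N}^{\mathbb{N}}$ is the set of functions $\mathbb{N}\to\mathbb{N}$; $f\le^* g$ means $f(n)\le g(n)$ for all but finitely many $n$. A subset of $\mathbb{N}^{\mathbb{N}}$ is dominating if it is cofinal in $(\mathbb{N}^{\mathbb{N}},\le^* )$. For finite $F\subseteq\mathbb{N}^{\mathbb{N}}$, $\max(F)(n)=\max\{f(n):f\in F\}$; $Y$ is finitely dominating if $\{\max(F):F\subseteq Y\text{ finite}\}$ is dominating. $\mathfrak{D}_{\mathrm{fin}}$ is the class of subsets of $\mathbb{N}^{\mathbb{N}}$ that are not finitely dominating and $\mathfrak{D}$ is the class of subsets that are not dominating. $\operatorname{add}(\mathfrak{D}_{\mathrm{fin}},\mathfrak{D})$ is the minimal cardinality of a family $\mathcal{F}\subseteq\mathfrak{D}_{\mathrm{fin}}$ with $\bigcup\mathcal{F}$ dominating. *)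

theory Defs
  imports "HOL-Library.Infinite_Set"
begin

unbundle cardinal_syntax

definition le_star :: "(nat \<Rightarrow> nat) \<Rightarrow> (nat \<Rightarrow> nat) \<Rightarrow> bool"  (infix "\<le>*" 50)
  where "f \<le>* g \<longleftrightarrow> (\<forall>\<^sub>\<infinity>n. f n \<le> g n)"

definition dominating :: "(nat \<Rightarrow> nat) set \<Rightarrow> bool"
  where "dominating Y \<longleftrightarrow> (\<forall>f. \<exists>g\<in>Y. f \<le>* g)"

text \<open>The pointwise maximum is only meaningful for finite nonempty \<open>F\<close>.\<close>

definition max_fun :: "(nat \<Rightarrow> nat) set \<Rightarrow> nat \<Rightarrow> nat"
  where "max_fun F n = Max ((\<lambda>f. f n) ` F)"

text \<open>Whether \<open>F = {}\<close> (with maximum the zero function) is admitted makes no difference: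
  a set containing only the zero function is not dominating, and for nonempty \<open>Y\<close> the zero
  function lies below some other maximum.\<close>

definition finitely_dominating :: "(nat \<Rightarrow> nat) set \<Rightarrow> bool"
  where "finitely_dominating Y \<longleftrightarrow>
    dominating {max_fun F | F. F \<subseteq> Y \<and> finite F \<and> F \<noteq> {}}"

definition D_fin :: "(nat \<Rightarrow> nat) set set"
  where "D_fin = {Y. \<not> finitely_dominating Y}"

definition D :: "(nat \<Rightarrow> nat) set set"
  where "D = {Y. \<not> dominating Y}"

text \<open>The minimal cardinality of a family of members of \<open>I\<close> whose union is not in \<open>J\<close>, as a
  cardinal order.  It is only meaningful if such a family exists, which is shown for
  \<open>D_fin\<close> and \<open>D\<close> in \<open>add_card_D_fin_D\<close> below; a least cardinality is then unique up to \<open>=o\<close>.\<close>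

definition add_card :: "'a set set \<Rightarrow> 'a set set \<Rightarrow> 'a set rel"
  where "add_card I J = (SOME r. (\<exists>F. F \<subseteq> I \<and> \<Union>F \<notin> J \<and> r = |F| ) \<and>
    (\<forall>F. F \<subseteq> I \<and> \<Union>F \<notin> J \<longrightarrow> r \<le>o |F| ))"

text \<open>An ultrafilter as an element of the filter type: \<open>A\<close> belongs to \<open>U\<close> iff
  \<open>eventually (\<lambda>x. x \<in> A) U\<close>.  That type contains the improper filter \<open>bot\<close>.\<close>

definition ultrafilter :: "'a filter \<Rightarrow> bool"
  where "ultrafilter U \<longleftrightarrow>
    U \<noteq> bot \<and> (\<forall>P. eventually P U \<or> eventually (\<lambda>x. \<not> P x) U)"

definition nonprincipal_ultrafilter :: "'a filter \<Rightarrow> bool"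
  where "nonprincipal_ultrafilter U \<longleftrightarrow> ultrafilter U \<and> (\<nexists>A. U = principal A)"

lemma not_finitely_dominating_singleton: "\<not> finitely_dominating {f}"
proof
  assume "finitely_dominating {f}"
  then obtain F where F: "F \<subseteq> {f}" "F \<noteq> {}" and le: "(\<lambda>n. Suc (f n)) \<le>* max_fun F"
    unfolding finitely_dominating_def dominating_def by blast
  from F have "F = {f}"
    by auto
  hence "max_fun F = f"
    by (simp add: max_fun_def fun_eq_iff)
  with le show False
    by (simp add: le_star_def)
qed

lemma add_card_D_fin_D:
  shows "\<exists>F. F \<subseteq> D_fin \<and> dominating (\<Union>F) \<and> add_card D_fin D = |F|"
    and "F \<subseteq> D_fin \<Longrightarrow> dominating (\<Union>F) \<Longrightarrow> add_card D_fin D \<le>o |F|"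
proof -
  define R where "R = {|F| | F. F \<subseteq> D_fin \<and> \<Union>F \<notin> D}"
  have "dominating (\<Union>(range (\<lambda>f. {f})))"
  proof -
    have "f \<le>* f" for f
      by (simp add: le_star_def)
    thus ?thesis
      unfolding dominating_def by blast
  qed
  moreover have "range (\<lambda>f. {f}) \<subseteq> D_fin"
    using not_finitely_dominating_singleton by (auto simp: D_fin_def)
  ultimately have "R \<noteq> {}"
    unfolding R_def D_def by blast
  moreover have "\<forall>r\<in>R. Card_order r"
    by (auto simp: R_def card_of_Card_order)
  ultimately obtain r where "r \<in> R" "\<forall>r'\<in>R. r \<le>o r'"
    using exists_minim_Card_order by blast
  hence "\<exists>r. (\<exists>F. F \<subseteq> D_fin \<and> \<Union>F \<notin> D \<and> r = |F| ) \<and>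
      (\<forall>F. F \<subseteq> D_fin \<and> \<Union>F \<notin> D \<longrightarrow> r \<le>o |F| )"
    unfolding R_def by blast
  note * = someI_ex[OF this, folded add_card_def]
  show "\<exists>F. F \<subseteq> D_fin \<and> dominating (\<Union>F) \<and> add_card D_fin D = |F|"
    using * by (simp add: D_def)
  show "F \<subseteq> D_fin \<Longrightarrow> dominating (\<Union>F) \<Longrightarrow> add_card D_fin D \<le>o |F|"
    using * by (simp add: D_def)
qed

end

(* A set Y is not finitely dominating iff some h and some nonprincipal ultrafilter U satisfy
   f < h modulo U for all f in Y: if no finite maximum dominates h, the sets {n. f n < h n}
   have infinite finite intersections, and conversely {f. f < h modulo U} is closed under finite
   maxima. So families in D_fin correspond to sequences of pairs (g, U), and h fails to be
   dominated by the union of the family iff g \<le> h modulo U for every pair. *)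

theory Submission
  imports Defs
begin

text \<open>Zorn's lemma, applied to the proper filters below \<open>F\<close> under the reversed
  order, gives a minimal proper filter, and minimality forces it to decide every predicate.\<close>

lemma exists_ultrafilter_le:
  assumes "F \<noteq> bot"
  shows "\<exists>U\<le>F. ultrafilter U"
proof -
  define A where "A = {G. G \<noteq> bot \<and> G \<le> F}"
  have "partial_order_on A (relation_of (\<ge>) A)"
    by (rule partial_order_on_relation_ofI) auto
  moreover have "\<exists>u\<in>A. \<forall>G\<in>C. u \<le> G" if "C \<in> Chains (relation_of (\<ge>) A)" for C
  proof (cases "C = {}")
    case True
    thus ?thesis
      using assms by (auto simp: A_def)
  next
    case False
    have chain: "G \<le> H \<or> H \<le> G" if "G \<in> C" "H \<in> C" for G H
      using \<open>C \<in> _\<close> that by (auto simp: Chains_def relation_of_def)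
    have CA: "C \<subseteq> A"
      using \<open>C \<in> _\<close> by (auto simp: Chains_def relation_of_def)
    \<comment> \<open>A nonempty chain is a filter base, so whatever holds eventually in its infimum
      already holds eventually in one member; for \<open>False\<close> this contradicts that the
      member is proper.\<close>
    have "Inf C \<noteq> bot"
    proof
      assume "Inf C = bot"
      hence "eventually (\<lambda>_. False) (Inf C)"
        by simp
      moreover have "\<exists>x\<in>C. x \<le> inf G H" if "G \<in> C" "H \<in> C" for G H
        using chain[OF that] that by (auto simp: inf_absorb1 inf_absorb2)
      ultimately obtain G where "G \<in> C" "eventually (\<lambda>_. False) G"
        using False by (subst (asm) eventually_Inf_base) auto
      thus False
        using CA by (auto simp: A_def trivial_limit_def)
    qed
    moreover have "Inf C \<le> F"
      using False CA by (auto simp: A_def intro: Inf_lower2)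
    ultimately show ?thesis
      by (auto simp: A_def intro!: bexI[of _ "Inf C"] Inf_lower)
  qed
  ultimately obtain U where U: "U \<in> A" and min: "\<And>G. G \<in> A \<Longrightarrow> G \<le> U \<Longrightarrow> G = U"
    using predicate_Zorn[of A "(\<ge>)"] by blast
  have "eventually P U" if "\<not> eventually (\<lambda>x. \<not> P x) U" for P
  proof -
    \<comment> \<open>Restricting \<open>U\<close> to \<open>P\<close> leaves a proper filter, so by
      minimality the restriction changes nothing and \<open>P\<close> already holds
      eventually.\<close>
    have "inf U (principal {x. P x}) \<noteq> bot"
      using that by (simp add: trivial_limit_def eventually_inf_principal)
    hence "inf U (principal {x. P x}) = U"
      using U by (intro min) (auto simp: A_def intro: le_infI1)
    hence "U \<le> principal {x. P x}"
      by (simp add: inf.absorb_iff1)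
    thus ?thesis
      by (simp add: le_principal)
  qed
  thus ?thesis
    using U by (auto simp: A_def ultrafilter_def)
qed

text \<open>An ultrafilter can be principal only at a single point, so being nonprincipal means
  omitting every singleton, hence every finite set. In the form \<open>U \<le> cofinite\<close> this
  transfers \<open>\<le>*\<close> to an inequality modulo \<open>U\<close>.\<close>

lemma nonprincipal_ultrafilter_iff_le_cofinite:
  fixes U :: "'a filter"
  shows "nonprincipal_ultrafilter U \<longleftrightarrow> ultrafilter U \<and> U \<le> cofinite"
proof (intro iffI conjI)
  assume U: "nonprincipal_ultrafilter U"
  thus ultra: "ultrafilter U"
    by (simp add: nonprincipal_ultrafilter_def)
  have ne: "eventually (\<lambda>x. x \<noteq> a) U" for a
  proof (rule ccontr)
    assume "\<not> eventually (\<lambda>x. x \<noteq> a) U"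
    hence a: "eventually (\<lambda>x. x = a) U"
      using ultra by (auto simp: ultrafilter_def)
    have "U = principal {a}"
    proof (rule antisym)
      show "U \<le> principal {a}"
        using a by (simp add: le_principal)
      have "P a" if "eventually P U" for P
      proof (rule ccontr)
        assume "\<not> P a"
        hence "eventually (\<lambda>_. False) U"
          using eventually_conj[OF that a] by (auto elim: eventually_mono)
        thus False
          using ultra by (simp add: ultrafilter_def trivial_limit_def)
      qed
      thus "principal {a} \<le> U"
        by (auto simp: le_filter_def eventually_principal)
    qed
    thus False
      using U by (auto simp: nonprincipal_ultrafilter_def)
  qed
  show "U \<le> cofinite"
  proof (rule filter_leI)
    fix P :: "'a \<Rightarrow> bool"
    assume "eventually P cofinite"
    hence "finite {x. \<not> P x}"
      by (simp add: eventually_cofinite)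
    hence "eventually (\<lambda>x. \<forall>a\<in>{x. \<not> P x}. x \<noteq> a) U"
      using ne by (intro eventually_ball_finite) auto
    thus "eventually P U"
      by (rule eventually_mono) blast
  qed
next
  assume U: "ultrafilter U \<and> U \<le> cofinite"
  have "U \<noteq> principal A" for A
  proof
    assume A: "U = principal A"
    then obtain a where "a \<in> A"
      using U by (cases "A = {}") (auto simp: ultrafilter_def)
    have "eventually (\<lambda>x. x \<noteq> a) U"
      using U by (auto simp: eventually_cofinite intro: filter_leD)
    thus False
      using A \<open>a \<in> A\<close> by (auto simp: eventually_principal)
  qed
  thus "nonprincipal_ultrafilter U"
    using U by (auto simp: nonprincipal_ultrafilter_def)
qed

text \<open>An infinite set meets every cofinite set, so the \<open>A i\<close> and the cofinite
  sets together generate a proper filter; any ultrafilter below it is as required.\<close>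

lemma nonprincipal_ultrafilter_containing:
  assumes "\<And>X. X \<subseteq> I \<Longrightarrow> finite X \<Longrightarrow> infinite (\<Inter>i\<in>X. A i)"
  shows "\<exists>U. nonprincipal_ultrafilter U \<and> (\<forall>i\<in>I. eventually (\<lambda>x. x \<in> A i) U)"
proof -
  define F where "F = inf cofinite (INF i\<in>I. principal (A i))"
  have "F \<noteq> bot"
  proof
    assume "F = bot"
    hence "eventually (\<lambda>_. False) F"
      by simp
    then obtain P Q where P: "eventually P cofinite"
        and Q: "eventually Q (INF i\<in>I. principal (A i))" and PQ: "\<And>x. \<not> (P x \<and> Q x)"
      unfolding F_def eventually_inf by blast
    \<comment> \<open>Finitely many \<open>A i\<close> already force \<open>Q\<close>; their
      intersection then lies in the finite complement of \<open>P\<close>.\<close>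
    obtain X where "X \<subseteq> I" "finite X" "eventually Q (INF i\<in>X. principal (A i))"
      using iffD1[OF eventually_INF Q] by blast
    moreover from this have "(\<Inter>i\<in>X. A i) \<subseteq> {x. \<not> P x}"
      using PQ by (auto simp: INF_principal_finite eventually_principal)
    ultimately show False
      using P assms[of X] by (auto simp: eventually_cofinite dest: finite_subset)
  qed
  then obtain U where U: "U \<le> F" "ultrafilter U"
    using exists_ultrafilter_le by blast
  have "eventually (\<lambda>x. x \<in> A i) U" if "i \<in> I" for i
  proof -
    have "U \<le> principal (A i)"
      using U(1) INF_lower[OF that, of "\<lambda>i. principal (A i)"]
      unfolding F_def le_inf_iff by (blast intro: order_trans)
    thus ?thesis
      by (simp add: le_principal)
  qed
  thus ?thesis
    using U by (auto simp: nonprincipal_ultrafilter_iff_le_cofinite F_def)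
qed

lemma max_fun_less_iff:
  assumes "finite F" "F \<noteq> {}"
  shows "max_fun F n < m \<longleftrightarrow> (\<forall>f\<in>F. f n < m)"
  using assms by (simp add: max_fun_def)

text \<open>The strict inequality comes from negating \<open>h \<le>* max_fun F\<close>: for
  infinitely many \<open>n\<close>, \<open>max_fun F n < h n\<close>, which says that every
  \<open>f\<close> in \<open>F\<close> is below \<open>h\<close> at \<open>n\<close>.\<close>

lemma D_fin_iff:
  "Y \<in> D_fin \<longleftrightarrow>
    (\<exists>h U. nonprincipal_ultrafilter U \<and> (\<forall>f\<in>Y. \<forall>\<^sub>F n in U. f n < h n))"
proof
  assume "Y \<in> D_fin"
  then obtain h where h: "\<And>F. F \<subseteq> Y \<Longrightarrow> finite F \<Longrightarrow> F \<noteq> {} \<Longrightarrow> \<not> h \<le>* max_fun F"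
    unfolding D_fin_def finitely_dominating_def dominating_def by blast
  have "infinite (\<Inter>f\<in>X. {n. f n < h n})" if X: "X \<subseteq> Y" "finite X" for X
  \<comment> \<open>The maximum of an empty set is meaningless, but the empty intersection is all of
    the natural numbers and so infinite.\<close>
  proof (cases "X = {}")
    case False
    have "(\<Inter>f\<in>X. {n. f n < h n}) = {n. \<not> h n \<le> max_fun X n}"
      using X(2) False by (auto simp: not_le max_fun_less_iff)
    thus ?thesis
      using h[OF X False] by (simp add: le_star_def eventually_cofinite)
  qed auto
  from nonprincipal_ultrafilter_containing[of Y "\<lambda>f. {n. f n < h n}", OF this]
  show "\<exists>h U. nonprincipal_ultrafilter U \<and> (\<forall>f\<in>Y. \<forall>\<^sub>F n in U. f n < h n)"
    by auto
next
  assume "\<exists>h U. nonprincipal_ultrafilter U \<and> (\<forall>f\<in>Y. \<forall>\<^sub>F n in U. f n < h n)"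
  then obtain h U where U: "U \<noteq> bot" "U \<le> cofinite"
      and less: "\<And>f. f \<in> Y \<Longrightarrow> \<forall>\<^sub>F n in U. f n < h n"
    by (auto simp: nonprincipal_ultrafilter_iff_le_cofinite ultrafilter_def)
  have "\<not> h \<le>* max_fun F" if F: "F \<subseteq> Y" "finite F" "F \<noteq> {}" for F
  proof
    assume "h \<le>* max_fun F"
    hence "\<forall>\<^sub>F n in U. h n \<le> max_fun F n"
      using U(2) by (auto simp: le_star_def intro: filter_leD)
    moreover have "\<forall>\<^sub>F n in U. \<forall>f\<in>F. f n < h n"
      using F less by (intro eventually_ball_finite) auto
    ultimately have "\<forall>\<^sub>F n in U. False"
      by eventually_elim (use F max_fun_less_iff in \<open>auto simp: not_less[symmetric]\<close>)
    thus False
      using U(1) by (simp add: trivial_limit_def)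
  qed
  thus "Y \<in> D_fin"
    unfolding D_fin_def finitely_dominating_def dominating_def by blast
qed

text \<open>In a linear order the two inequalities define complementary sets, and an ultrafilter
  contains exactly one of them.\<close>

lemma ultrafilter_eventually_le_iff:
  fixes f g :: "'a \<Rightarrow> 'b::linorder"
  assumes "ultrafilter U"
  shows "(\<forall>\<^sub>F n in U. f n \<le> g n) \<longleftrightarrow> \<not> (\<forall>\<^sub>F n in U. g n < f n)"
proof
  assume le: "\<forall>\<^sub>F n in U. f n \<le> g n"
  show "\<not> (\<forall>\<^sub>F n in U. g n < f n)"
  proof
    assume "\<forall>\<^sub>F n in U. g n < f n"
    with le have "\<forall>\<^sub>F n in U. False"
      by eventually_elim simp
    thus False
      using assms by (simp add: ultrafilter_def trivial_limit_def)
  qed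
next
  assume "\<not> (\<forall>\<^sub>F n in U. g n < f n)"
  hence "\<forall>\<^sub>F n in U. \<not> g n < f n"
    using assms unfolding ultrafilter_def by blast
  thus "\<forall>\<^sub>F n in U. f n \<le> g n"
    by (simp add: not_less)
qed

theorem theorem4p2:
  fixes \<kappa> :: "'k rel"
  assumes "Card_order \<kappa>"
  shows "\<kappa> <o add_card D_fin D \<longleftrightarrow>
    (\<forall>(g :: 'k \<Rightarrow> nat \<Rightarrow> nat) (U :: 'k \<Rightarrow> nat filter).
      (\<forall>\<alpha>\<in>Field \<kappa>. nonprincipal_ultrafilter (U \<alpha>)) \<longrightarrow>
      (\<exists>h :: nat \<Rightarrow> nat. \<forall>\<alpha>\<in>Field \<kappa>. \<forall>\<^sub>F n in U \<alpha>. g \<alpha> n \<le> h n))"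
proof (intro iffI allI impI)
  fix g :: "'k \<Rightarrow> nat \<Rightarrow> nat" and U :: "'k \<Rightarrow> nat filter"
  assume less: "\<kappa> <o add_card D_fin D"
    and U: "\<forall>\<alpha>\<in>Field \<kappa>. nonprincipal_ultrafilter (U \<alpha>)"
  \<comment> \<open>The largest member of \<open>D_fin\<close> that the pair of
    \<open>g \<alpha>\<close> and \<open>U \<alpha>\<close> witnesses.\<close>
  define Y where "Y \<alpha> = {f. \<forall>\<^sub>F n in U \<alpha>. f n < g \<alpha> n}" for \<alpha>
  have "Y ` Field \<kappa> \<subseteq> D_fin"
    unfolding Y_def
  proof (intro image_subsetI)
    fix \<alpha>
    assume "\<alpha> \<in> Field \<kappa>"
    with U show "{f. \<forall>\<^sub>F n in U \<alpha>. f n < g \<alpha> n} \<in> D_fin"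
      unfolding D_fin_iff by (intro exI[of _ "g \<alpha>"] exI[of _ "U \<alpha>"]) simp
  qed
  moreover have "|Y ` Field \<kappa>| <o add_card D_fin D"
    using ordLeq_ordIso_trans[OF card_of_image card_of_Field_ordIso[OF assms]] less
    by (rule ordLeq_ordLess_trans)
  ultimately have "\<not> dominating (\<Union>(Y ` Field \<kappa>))"
    using add_card_D_fin_D(2) not_ordLess_ordLeq by blast
  then obtain h where h: "\<And>f. f \<in> \<Union>(Y ` Field \<kappa>) \<Longrightarrow> \<not> h \<le>* f"
    unfolding dominating_def by blast
  \<comment> \<open>By reflexivity \<open>h\<close> itself lies in no \<open>Y \<alpha>\<close>, and
    the ultrafilter dichotomy turns this into the desired bound.\<close>
  have "h \<le>* h"
    by (simp add: le_star_def)
  hence "\<forall>\<^sub>F n in U \<alpha>. g \<alpha> n \<le> h n" if "\<alpha> \<in> Field \<kappa>" for \<alpha>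
    using h[of h] U that
    by (auto simp: Y_def ultrafilter_eventually_le_iff nonprincipal_ultrafilter_def)
  thus "\<exists>h. \<forall>\<alpha>\<in>Field \<kappa>. \<forall>\<^sub>F n in U \<alpha>. g \<alpha> n \<le> h n"
    by blast
next
  assume bounded: "\<forall>(g :: 'k \<Rightarrow> nat \<Rightarrow> nat) (U :: 'k \<Rightarrow> nat filter).
      (\<forall>\<alpha>\<in>Field \<kappa>. nonprincipal_ultrafilter (U \<alpha>)) \<longrightarrow>
      (\<exists>h :: nat \<Rightarrow> nat. \<forall>\<alpha>\<in>Field \<kappa>. \<forall>\<^sub>F n in U \<alpha>. g \<alpha> n \<le> h n)"
  obtain F where F: "F \<subseteq> D_fin" "dominating (\<Union>F)" "add_card D_fin D = |F|"
    using add_card_D_fin_D(1) by blast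
  show "\<kappa> <o add_card D_fin D"
  proof (rule ccontr)
    assume "\<not> \<kappa> <o add_card D_fin D"
    hence "|F| \<le>o \<kappa>"
      using ordLess_or_ordLeq[OF card_order_on_well_order_on[OF assms] card_of_Well_order] F(3)
      by metis
    hence "|F| \<le>o |Field \<kappa>|"
      using card_of_Field_ordIso[OF assms] ordIso_symmetric ordLeq_ordIso_trans by blast
    \<comment> \<open>A nonempty \<open>F\<close> of at most this size is the image of
      \<open>Field \<kappa>\<close>, with repetitions allowed, so it can be indexed by all of
      \<open>Field \<kappa>\<close>.\<close>
    moreover have "F \<noteq> {}"
      using F(2) by (auto simp: dominating_def)
    ultimately obtain Y where Y: "Y ` Field \<kappa> = F"
      by (metis card_of_ordLeq2)
    have "\<forall>\<alpha>\<in>Field \<kappa>. \<exists>g U. nonprincipal_ultrafilter U \<and> (\<forall>f\<in>Y \<alpha>. \<forall>\<^sub>F n in U. f n < g n)"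
      using Y F(1) D_fin_iff by blast
    then obtain g U where U: "\<And>\<alpha>. \<alpha> \<in> Field \<kappa> \<Longrightarrow> nonprincipal_ultrafilter (U \<alpha>)"
        and less: "\<And>\<alpha> f. \<alpha> \<in> Field \<kappa> \<Longrightarrow> f \<in> Y \<alpha> \<Longrightarrow> \<forall>\<^sub>F n in U \<alpha>. f n < g \<alpha> n"
      by metis
    then obtain h where h: "\<And>\<alpha>. \<alpha> \<in> Field \<kappa> \<Longrightarrow> \<forall>\<^sub>F n in U \<alpha>. g \<alpha> n \<le> h n"
      using bounded by metis
    \<comment> \<open>Some \<open>f\<close> in the dominating union lies above the common bound
      \<open>h\<close>, which closes the cycle \<open>f < g \<alpha> \<le> h \<le> f\<close> modulo
      \<open>U \<alpha>\<close>.\<close>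
    obtain \<alpha> f where \<alpha>: "\<alpha> \<in> Field \<kappa>" "f \<in> Y \<alpha>" and "h \<le>* f"
      using F(2) Y unfolding dominating_def by blast
    hence "\<forall>\<^sub>F n in U \<alpha>. h n \<le> f n"
      using U by (auto simp: le_star_def nonprincipal_ultrafilter_iff_le_cofinite intro: filter_leD)
    with less[OF \<alpha>] h[OF \<alpha>(1)] have "\<forall>\<^sub>F n in U \<alpha>. False"
      by eventually_elim simp
    thus False
      using U[OF \<alpha>(1)]
      by (simp add: nonprincipal_ultrafilter_def ultrafilter_def trivial_limit_def)
  qed
qed

end
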